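(* Let $\mathcal{I}$ and $\mathcal{J}$ be ideals on $\omega$ such that $\mathcal{I}\le_{\mathrm{RK}}\mathcal{J}$. Then there exists an infinite real matrix $A\in(\ell_\infty,\ell_\infty)$ such that $$\mathrm{core}_{A\bm{x}}(\mathcal{J})=\mathrm{core}_{\bm{x}}(\mathcal{I})\quad\text{for all sequences }\bm{x}\in\ell_\infty.$$
   Context: $\omega$ is the set of natural numbers (including $0$). An ideal $\mathcal{I}$ on $\omega$ is a family of subsets of $\omega$ closed under subsets and finite unions; it is always assumed that $\mathcal{I}$ contains all finite subsets of $\omega$ and that $\omega\notin\mathcal{I}$. Write $\mathcal{I}^\star:=\{S\subseteq\omega:\omega\setminus S\in\mathcal{I}\}$. $\mathcal{I}$ is Rudin--Keisler below $\mathcal{J}$, written $\mathcal{I}\le_{\mathrm{RK}}\mathcal{J}$, if there exists a map $h:\omega\to\omega$ such that, for every $S\subseteq\omega$, $S\in\mathcal{I}$ if and only if $h^{-1}[S]\in\mathcal{J}$. $\ell_\infty$ is the space of bounded real sequences indexed by $\omega$. For a real sequence $\bm{x}=(x_n:n\in\omega)$, its $\mathcal{I}$-core is $\mathrm{core}_{\bm{x}}(\mathcal{I}):=\bigcap_{S\in\mathcal{I}^\star}\overline{\mathrm{co}}\{x_n:n\in S\}$, where $\overline{\mathrm{co}}$ denotes the closed convex hull. For an infinite real matrix $A=(a_{n,k}:n,k\in\omega)$ and a real sequence $\bm{x}$, $A\bm{x}$ is the sequence whose $n$-th term is $\sum_{k\in\omega}a_{n,k}x_k$, defined if every such series converges to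 a real number. $A\in(\ell_\infty,\ell_\infty)$ means that $A\bm{x}$ is defined and bounded for all $\bm{x}\in\ell_\infty$. *)

theory Defs
  imports "HOL-Analysis.Analysis"
begin

text \<open>Ideals on the natural numbers are always proper and contain all finite sets.\<close>

definition nat_ideal :: "nat set set \<Rightarrow> bool" where
  "nat_ideal I \<longleftrightarrow>
     (\<forall>S\<in>I. \<forall>T. T \<subseteq> S \<longrightarrow> T \<in> I) \<and>
     (\<forall>S\<in>I. \<forall>T\<in>I. S \<union> T \<in> I) \<and>
     (\<forall>S. finite S \<longrightarrow> S \<in> I) \<and>
     UNIV \<notin> I"

definition dual_filter :: "nat set set \<Rightarrow> nat set set" where
  "dual_filter I = {S. - S \<in> I}"

definition RK_below :: "nat set set \<Rightarrow> nat set set \<Rightarrow> bool" (infix "\<le>\<^sub>R\<^sub>K" 50) where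
  "I \<le>\<^sub>R\<^sub>K J \<longleftrightarrow> (\<exists>h :: nat \<Rightarrow> nat. \<forall>S. S \<in> I \<longleftrightarrow> h -` S \<in> J)"

definition ell_infty :: "(nat \<Rightarrow> real) set" where
  "ell_infty = {x. bounded (range x)}"

definition ideal_core :: "nat set set \<Rightarrow> (nat \<Rightarrow> real) \<Rightarrow> real set" where
  "ideal_core I x = (\<Inter>S\<in>dual_filter I. closure (convex hull (x ` S)))"

text \<open>
  The transform of \<open>x\<close> by the infinite matrix \<open>A\<close> is meaningful only if \<open>transform_defined A x\<close>
  holds, since \<open>suminf\<close> is unspecified on divergent series. The series are ordinary
  (not necessarily absolutely) convergent ones.
\<close>

definition transform_defined :: "(nat \<Rightarrow> nat \<Rightarrow> real) \<Rightarrow> (nat \<Rightarrow> real) \<Rightarrow> bool" where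
  "transform_defined A x \<longleftrightarrow> (\<forall>n. summable (\<lambda>k. A n k * x k))"

definition transform :: "(nat \<Rightarrow> nat \<Rightarrow> real) \<Rightarrow> (nat \<Rightarrow> real) \<Rightarrow> nat \<Rightarrow> real" where
  "transform A x = (\<lambda>n. \<Sum>k. A n k * x k)"

definition matrix_class ::
    "(nat \<Rightarrow> real) set \<Rightarrow> (nat \<Rightarrow> real) set \<Rightarrow> (nat \<Rightarrow> nat \<Rightarrow> real) set" where
  "matrix_class X Y = {A. \<forall>x\<in>X. transform_defined A x \<and> transform A x \<in> Y}"

end

theory Submission
  imports Defs
begin

text \<open>
  If \<open>h\<close> witnesses that \<open>I\<close> is Rudin--Keisler below \<open>J\<close>, the matrix with a single \<open>1\<close> in
  column \<open>h n\<close> of each row \<open>n\<close> maps \<open>x\<close> to \<open>x \<circ> h\<close>. The cores then agree because preimages under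
  \<open>h\<close> of sets in the dual filter of \<open>I\<close>, and images of sets in the dual filter of \<open>J\<close>, lie again
  in the respective dual filters.
\<close>

lemma sums_single_entry: "(\<lambda>k. (if k = m then 1 else 0) * x k) sums (x m :: real)"
proof -
  have "(\<lambda>k. (if k = m then 1 else 0) * x k) = (\<lambda>k. if k = m then x k else 0)"
    by auto
  then show ?thesis
    using sums_single[of m x] by simp
qed

lemma transform_defined_selection:
  "transform_defined (\<lambda>n k. if k = h n then 1 else 0) x"
  unfolding transform_defined_def using sums_single_entry sums_summable by blast

lemma transform_selection:
  "transform (\<lambda>n k. if k = h n then 1 else 0) x = x \<circ> h"
  unfolding transform_def using sums_unique[OF sums_single_entry] by fastforce

lemma selection_in_matrix_class:
  "(\<lambda>n k. if k = h n then 1 else 0) \<in> matrix_class ell_infty ell_infty"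
proof -
  have "bounded (range (x \<circ> h))" if "bounded (range x)" for x :: "nat \<Rightarrow> real"
    by (rule bounded_subset[OF that]) auto
  then show ?thesis
    by (simp add: matrix_class_def ell_infty_def transform_defined_selection transform_selection)
qed

text \<open>Each inclusion is proved termwise: every hull in the larger intersection contains some
  hull in the smaller one.\<close>

lemma ideal_core_comp:
  assumes J: "nat_ideal J" and h: "\<And>S. S \<in> I \<longleftrightarrow> h -` S \<in> J"
  shows "ideal_core J (x \<circ> h) = ideal_core I x"
proof
  show "ideal_core J (x \<circ> h) \<subseteq> ideal_core I x"
    unfolding ideal_core_def
  proof (rule INF_mono)
    fix S assume "S \<in> dual_filter I"
    then have "h -` S \<in> dual_filter J"
      using h[of "- S"] by (simp add: dual_filter_def vimage_Compl)
    \<comment> \<open>Only an inclusion, as \<open>h\<close> need not be onto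
      \<open>S\<close>.\<close>
    moreover have "closure (convex hull ((x \<circ> h) ` (h -` S))) \<subseteq> closure (convex hull (x ` S))"
      by (intro closure_mono hull_mono) auto
    ultimately show "\<exists>T\<in>dual_filter J.
        closure (convex hull ((x \<circ> h) ` T)) \<subseteq> closure (convex hull (x ` S))" ..
  qed
  show "ideal_core I x \<subseteq> ideal_core J (x \<circ> h)"
    unfolding ideal_core_def
  proof (rule INF_mono)
    fix T assume "T \<in> dual_filter J"
    \<comment> \<open>No point of \<open>T\<close> is mapped outside the image of \<open>T\<close>;
      downward closure of \<open>J\<close> does the rest.\<close>
    moreover have "h -` (- (h ` T)) \<subseteq> - T"
      by auto
    ultimately have "h -` (- (h ` T)) \<in> J"
      using J unfolding nat_ideal_def dual_filter_def by blast
    then have "h ` T \<in> dual_filter I"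
      using h by (simp add: dual_filter_def)
    \<comment> \<open>For the image of \<open>T\<close> the two hulls coincide.\<close>
    then show "\<exists>S\<in>dual_filter I.
        closure (convex hull (x ` S)) \<subseteq> closure (convex hull ((x \<circ> h) ` T))"
      by (intro bexI[of _ "h ` T"]) (simp_all add: image_comp)
  qed
qed

theorem theorem2p4:
  fixes I J :: "nat set set"
  assumes "nat_ideal I" and "nat_ideal J" and "I \<le>\<^sub>R\<^sub>K J"
  shows "\<exists>A \<in> matrix_class ell_infty ell_infty.
           \<forall>x \<in> ell_infty. ideal_core J (transform A x) = ideal_core I x"
proof -
  obtain h where "\<And>S. S \<in> I \<longleftrightarrow> h -` S \<in> J"
    using assms(3) unfolding RK_below_def by blast
  from ideal_core_comp[OF assms(2) this] show ?thesis
    by (intro bexI[OF _ selection_in_matrix_class[of h]]) (simp add: transform_selection)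
qed

end
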